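(* For all $j>i\ge1$ with $b_j^d>0$, $$c(i,j)=\frac{b_{j-1}^w c(i,j-1)-b_{j-2}^u c(i,j-2)+\delta_{i+1,j}}{b_j^d},$$ where $\delta_{i,j}$ equals $1$ if $i=j$ and $0$ otherwise.
   Context: Indices run over $0,1,2,\ldots$. Let $b_i^d,b_i^u$ ($i\ge 0$) and $b_i^z$ ($i\ge1$) be non-negative real numbers and let $b_i^w=b_i^z+b_i^d+b_i^u>0$ for $i\ge1$. The infinite matrix $B=(B(i,j))_{i,j\ge0}$ is defined by: $B(0,0)=-b_0^d-b_0^u$, $B(0,1)=b_0^u$; $B(1,0)=b_1^d+b_1^z$, $B(1,1)=-b_1^w$, $B(1,2)=b_1^u$; and for $i\ge2$: $B(i,0)=b_i^z$, $B(i,i-1)=b_i^d$, $B(i,i)=-b_i^w$, $B(i,i+1)=b_i^u$; all other entries are $0$. It is assumed that $b_i^d>0$ and $b_i^u>0$ for all $i\ge0$. $C=(c(i,j))_{i,j\ge0}$ denotes the inverse of $B$, i.e. $C=B^{-1}$, so that $CB=BC=I$. *)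

theory Defs
  imports Complex_Main
begin

definition kdelta :: "nat \<Rightarrow> nat \<Rightarrow> real" where
  "kdelta i j = (if i = j then 1 else 0)"

text \<open>The value at index 0 is never used, neither here nor for \<open>bz\<close> below.\<close>

definition bw :: "(nat \<Rightarrow> real) \<Rightarrow> (nat \<Rightarrow> real) \<Rightarrow> (nat \<Rightarrow> real) \<Rightarrow> nat \<Rightarrow> real" where
  "bw bd bu bz i = bz i + bd i + bu i"

definition Bmat ::
  "(nat \<Rightarrow> real) \<Rightarrow> (nat \<Rightarrow> real) \<Rightarrow> (nat \<Rightarrow> real) \<Rightarrow> nat \<Rightarrow> nat \<Rightarrow> real" where
  "Bmat bd bu bz i j =
     (if i = 0 then
        (if j = 0 then - bd 0 - bu 0 else if j = 1 then bu 0 else 0)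
      else if i = 1 then
        (if j = 0 then bd 1 + bz 1
         else if j = 1 then - bw bd bu bz 1
         else if j = 2 then bu 1 else 0)
      else
        (if j = 0 then bz i
         else if j = i - 1 then bd i
         else if j = i then - bw bd bu bz i
         else if j = i + 1 then bu i else 0))"

text \<open>
  Each entry of a product of infinite matrices is the sum of a series; \<open>is_matprod X Y Z\<close>
  includes the requirement that all these series converge. The value of such a series need
  not be preserved by reordering, and it is summed in the natural order of the indices.
\<close>

definition is_matprod ::
  "(nat \<Rightarrow> nat \<Rightarrow> real) \<Rightarrow> (nat \<Rightarrow> nat \<Rightarrow> real) \<Rightarrow> (nat \<Rightarrow> nat \<Rightarrow> real) \<Rightarrow> bool" where
  "is_matprod X Y Z \<longleftrightarrow> (\<forall>i j. (\<lambda>k. X i k * Y k j) sums Z i j)"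

definition is_inverse_mat :: "(nat \<Rightarrow> nat \<Rightarrow> real) \<Rightarrow> (nat \<Rightarrow> nat \<Rightarrow> real) \<Rightarrow> bool" where
  "is_inverse_mat C B \<longleftrightarrow> is_matprod C B kdelta \<and> is_matprod B C kdelta"

end

theory Submission
  imports Defs
begin

text \<open>
  The recurrence is the entry \<open>(i, j - 1)\<close> of the equation \<open>CB = I\<close>. The jumps back to \<open>0\<close>
  fill only column \<open>0\<close> of \<open>B\<close>; every other column \<open>n + 1\<close> has just the three tridiagonal
  entries (\<open>Bmat_column_Suc\<close>), so the series for that entry is a sum of three terms
  (\<open>left_inverse_three_term\<close>). With \<open>j = n + 2\<close> it can be solved for \<open>c(i, j)\<close>, whose
  coefficient is \<open>b\<^sub>j\<^sup>d\<close>. The hypothesis \<open>j > i \<ge> 1\<close> gives \<open>j \<ge> 2\<close>, which is what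
  keeps the column index \<open>j - 1\<close> away from \<open>0\<close>.
\<close>

lemma Bmat_column_Suc:
  "Bmat bd bu bz k (Suc n) =
     (if k = n then bu n
      else if k = Suc n then - bw bd bu bz (Suc n)
      else if k = Suc (Suc n) then bd (Suc (Suc n))
      else 0)"
  by (auto simp: Bmat_def)

text \<open>
  The series collapses to a finite sum because column \<open>n + 1\<close> has finite support. Column \<open>0\<close>
  admits no such formula: the jumps to \<open>0\<close> may give it infinitely many nonzero entries.
\<close>

lemma left_inverse_three_term:
  assumes "is_matprod c (Bmat bd bu bz) kdelta"
  shows "bu n * c i n - bw bd bu bz (Suc n) * c i (Suc n) + bd (Suc (Suc n)) * c i (Suc (Suc n))
           = kdelta i (Suc n)"
proof -
  let ?f = "\<lambda>k. c i k * Bmat bd bu bz k (Suc n)"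
  have "?f sums (\<Sum>k\<in>{n, Suc n, Suc (Suc n)}. ?f k)"
    by (rule sums_finite) (auto simp: Bmat_column_Suc)
  moreover have "?f sums kdelta i (Suc n)"
    using assms by (simp add: is_matprod_def)
  ultimately have "(\<Sum>k\<in>{n, Suc n, Suc (Suc n)}. ?f k) = kdelta i (Suc n)"
    by (rule sums_unique2)
  then show ?thesis
    by (simp add: Bmat_column_Suc algebra_simps)
qed

theorem proposition5:
  fixes bd bu bz :: "nat \<Rightarrow> real" and c :: "nat \<Rightarrow> nat \<Rightarrow> real" and i j :: nat
  assumes "\<And>k. bd k \<ge> 0" and "\<And>k. bu k \<ge> 0" and "\<And>k. k \<ge> 1 \<Longrightarrow> bz k \<ge> 0"
    and "\<And>k. k \<ge> 1 \<Longrightarrow> bw bd bu bz k > 0"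
    and "\<And>k. bd k > 0" and "\<And>k. bu k > 0"
    and "is_inverse_mat c (Bmat bd bu bz)"
    and "i \<ge> 1" and "j > i" and "bd j > 0"
  shows "c i j = (bw bd bu bz (j - 1) * c i (j - 1) - bu (j - 2) * c i (j - 2)
                   + kdelta (i + 1) j) / bd j"
proof -
  obtain n where j: "j = Suc (Suc n)"
  proof
    show "j = Suc (Suc (j - 2))" using \<open>i \<ge> 1\<close> \<open>j > i\<close> by linarith
  qed
  have "is_matprod c (Bmat bd bu bz) kdelta"
    using assms(7) by (simp add: is_inverse_mat_def)
  then have "bu n * c i n - bw bd bu bz (Suc n) * c i (Suc n) + bd j * c i j = kdelta i (Suc n)"
    unfolding j by (rule left_inverse_three_term)
  moreover have "kdelta i (Suc n) = kdelta (i + 1) j"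
    by (simp add: kdelta_def j)
  ultimately have "bd j * c i j = bw bd bu bz (Suc n) * c i (Suc n) - bu n * c i n + kdelta (i + 1) j"
    by linarith
  then show ?thesis
    using \<open>bd j > 0\<close> by (simp add: j field_simps)
qed

end
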